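(* Let $$W=\begin{bmatrix} 1 & \frac{2}{\sqrt{6}} & 0 & 0 & \frac{1}{3}\\ \frac{2}{\sqrt{6}} & 1 & \frac{1}{2} & 0 & 0\\ 0 & \frac{1}{2} & 1 & \frac{1}{2} & 0\\ 0 & 0 & \frac{1}{2} & 1 & \frac{2}{\sqrt{6}}\\ \frac{1}{3} & 0 & 0 & \frac{2}{\sqrt{6}} & 1 \end{bmatrix}.$$ The Schur product map $S_W:M_5(\mathbb{C})\to M_5(\mathbb{C})$, $S_W(X)=X\circ W$ (entrywise product), is not positively factorizable, although its Choi matrix is an entrywise nonnegative positive semidefinite matrix.
   Context: The Choi matrix of a linear map $\Phi$ on $M_n(\mathbb{C})$ is $J(\Phi)=\sum_{i,j=1}^n E_{ij}\otimes\Phi(E_{ij})$, where $E_{ij}$ are the matrix units. A completely positive trace-preserving map $\Phi:M_n(\mathbb{C})\to M_n(\mathbb{C})$ is positively factorizable if there exist a finite von Neumann algebra $\mathcal{A}$ with a faithful normal (finite) trace $\tau$ and $Z=(Z(i,j))\in M_n(\mathbb{C})\otimes\mathcal{A}=M_n(\mathcal{A})$, each entry $Z(i,j)$ being a positive element of $\mathcal{A}$, such that $\Phi(X)=(\mathrm{id}\otimes\tau)(Z(X\otimes 1_{\mathcal{A}})Z^* )$ for all $X\in M_n(\mathbb{C})$. *)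

theory Defs
  imports "HOL-Analysis.Analysis" "HOL-Library.Complex_Order"
begin

section \<open>Complex Hilbert spaces\<close>

text \<open>The inner product is conjugate-linear in the first argument. The order on
  \<^typ>\<open>complex\<close> is that of \<^theory>\<open>HOL-Library.Complex_Order\<close>: \<^prop>\<open>0 \<le> (z::complex)\<close>
  means that \<^term>\<open>z\<close> is real and nonnegative.\<close>

class chilbert_space = banach +
  fixes scaleC :: "complex \<Rightarrow> 'a \<Rightarrow> 'a"
    and cinner :: "'a \<Rightarrow> 'a \<Rightarrow> complex"
  assumes scaleC_add_right: "scaleC a (x + y) = scaleC a x + scaleC a y"
    and scaleC_add_left: "scaleC (a + b) x = scaleC a x + scaleC b x"
    and scaleC_scaleC: "scaleC a (scaleC b x) = scaleC (a * b) x"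
    and scaleC_of_real: "scaleC (complex_of_real r) x = r *\<^sub>R x"
    and cinner_commute: "cinner x y = cnj (cinner y x)"
    and cinner_add_right: "cinner x (y + z) = cinner x y + cinner x z"
    and cinner_scaleC_right: "cinner x (scaleC a y) = a * cinner x y"
    and cinner_self: "cinner x x = complex_of_real ((norm x)\<^sup>2)"

instantiation complex :: chilbert_space
begin
definition "scaleC a x = a * (x::complex)"
definition "cinner x y = cnj x * (y::complex)"
instance
proof
  fix a b x y z :: complex and r :: real
  show "scaleC a (x + y) = scaleC a x + scaleC a y"
    by (simp add: scaleC_complex_def distrib_left)
  show "scaleC (a + b) x = scaleC a x + scaleC b x"
    by (simp add: scaleC_complex_def distrib_right)
  show "scaleC a (scaleC b x) = scaleC (a * b) x"
    by (simp add: scaleC_complex_def mult.assoc)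
  show "scaleC (complex_of_real r) x = r *\<^sub>R x"
    by (simp add: scaleC_complex_def scaleR_conv_of_real)
  show "cinner x y = cnj (cinner y x)"
    by (simp add: cinner_complex_def mult.commute)
  show "cinner x (y + z) = cinner x y + cinner x z"
    by (simp add: cinner_complex_def distrib_left)
  show "cinner x (scaleC a y) = a * cinner x y"
    by (simp add: cinner_complex_def scaleC_complex_def mult.left_commute)
  show "cinner x x = complex_of_real ((norm x)\<^sup>2)"
    by (simp only: cinner_complex_def complex_norm_square mult.commute)
qed
end

lemma norm_scaleC: "norm (scaleC c x) = cmod c * norm (x::'h::chilbert_space)"
proof -
  have "complex_of_real ((norm (scaleC c x))\<^sup>2) = cinner (scaleC c x) (scaleC c x)"
    by (simp add: cinner_self)
  also have "\<dots> = c * cinner (scaleC c x) x"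
    by (rule cinner_scaleC_right)
  also have "cinner (scaleC c x) x = cnj (cinner x (scaleC c x))"
    by (rule cinner_commute)
  also have "cinner x (scaleC c x) = c * complex_of_real ((norm x)\<^sup>2)"
    by (simp only: cinner_scaleC_right cinner_self)
  also have "c * cnj (c * complex_of_real ((norm x)\<^sup>2)) =
      (c * cnj c) * complex_of_real ((norm x)\<^sup>2)"
    by (simp only: complex_cnj_mult complex_cnj_complex_of_real mult.assoc)
  also have "\<dots> = complex_of_real ((cmod c * norm x)\<^sup>2)"
    by (simp only: complex_norm_square[symmetric] power_mult_distrib of_real_mult)
  finally have "(norm (scaleC c x))\<^sup>2 = (cmod c * norm x)\<^sup>2"
    by (simp only: of_real_eq_iff)
  then show ?thesis
    by (simp add: power2_eq_iff_nonneg)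
qed

section \<open>Bounded operators and von Neumann algebras\<close>

text \<open>A bounded operator on \<^typ>\<open>'h\<close> is an element of \<^typ>\<open>'h::chilbert_space \<Rightarrow>\<^sub>L 'h\<close>
  (bounded and real-linear) that is moreover complex-linear.\<close>

definition bounded_ops :: "('h::chilbert_space \<Rightarrow>\<^sub>L 'h) set" where
  "bounded_ops = {T. \<forall>c x. blinfun_apply T (scaleC c x) = scaleC c (blinfun_apply T x)}"

lift_definition scalar_op :: "complex \<Rightarrow> ('h::chilbert_space \<Rightarrow>\<^sub>L 'h)" is "\<lambda>c x. scaleC c x"
proof -
  fix c :: complex
  show "bounded_linear (\<lambda>x::'h. scaleC c x)"
  proof (rule bounded_linear_intro)
    show "scaleC c (r *\<^sub>R x) = r *\<^sub>R scaleC c x" for r and x :: 'h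
      by (simp add: scaleC_of_real[symmetric] scaleC_scaleC mult.commute)
    show "norm (scaleC c x) \<le> norm x * cmod c" for x :: 'h
      by (simp add: norm_scaleC mult.commute)
  qed (rule scaleC_add_right)
qed

text \<open>The adjoint exists by the Riesz representation theorem and is unique.\<close>

definition adj :: "('h::chilbert_space \<Rightarrow>\<^sub>L 'h) \<Rightarrow> ('h \<Rightarrow>\<^sub>L 'h)" where
  "adj T = (THE S. S \<in> bounded_ops \<and>
     (\<forall>x y. cinner (blinfun_apply S x) y = cinner x (blinfun_apply T y)))"

definition positive_op :: "('h::chilbert_space \<Rightarrow>\<^sub>L 'h) \<Rightarrow> bool" where
  "positive_op T \<longleftrightarrow> T \<in> bounded_ops \<and> (\<forall>x. 0 \<le> cinner x (blinfun_apply T x))"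

definition commutant :: "('h::chilbert_space \<Rightarrow>\<^sub>L 'h) set \<Rightarrow> ('h \<Rightarrow>\<^sub>L 'h) set" where
  "commutant A = {T \<in> bounded_ops. \<forall>S\<in>A. T o\<^sub>L S = S o\<^sub>L T}"

definition unital_star_subalgebra :: "('h::chilbert_space \<Rightarrow>\<^sub>L 'h) set \<Rightarrow> bool" where
  "unital_star_subalgebra A \<longleftrightarrow>
     A \<subseteq> bounded_ops \<and> id_blinfun \<in> A \<and>
     (\<forall>S\<in>A. \<forall>T\<in>A. S + T \<in> A \<and> S o\<^sub>L T \<in> A) \<and>
     (\<forall>c. \<forall>T\<in>A. scalar_op c o\<^sub>L T \<in> A) \<and>
     (\<forall>T\<in>A. adj T \<in> A)"

definition von_neumann_algebra :: "('h::chilbert_space \<Rightarrow>\<^sub>L 'h) set \<Rightarrow> bool" where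
  "von_neumann_algebra A \<longleftrightarrow> unital_star_subalgebra A \<and> commutant (commutant A) = A"

text \<open>Finiteness: the unit is a finite projection, i.e. every isometry in the algebra is unitary.\<close>

definition finite_von_neumann_algebra :: "('h::chilbert_space \<Rightarrow>\<^sub>L 'h) set \<Rightarrow> bool" where
  "finite_von_neumann_algebra A \<longleftrightarrow> von_neumann_algebra A \<and>
     (\<forall>V\<in>A. adj V o\<^sub>L V = id_blinfun \<longrightarrow> V o\<^sub>L adj V = id_blinfun)"

section \<open>Faithful normal finite traces\<close>

text \<open>A finite trace is an everywhere defined positive linear functional (not necessarily
  normalised) with the trace property. Only its values on the algebra matter.\<close>

definition finite_trace :: "('h::chilbert_space \<Rightarrow>\<^sub>L 'h) set \<Rightarrow> (('h \<Rightarrow>\<^sub>L 'h) \<Rightarrow> complex) \<Rightarrow> bool" where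
  "finite_trace A \<tau> \<longleftrightarrow>
     (\<forall>S\<in>A. \<forall>T\<in>A. \<tau> (S + T) = \<tau> S + \<tau> T) \<and>
     (\<forall>c. \<forall>T\<in>A. \<tau> (scalar_op c o\<^sub>L T) = c * \<tau> T) \<and>
     (\<forall>T\<in>A. positive_op T \<longrightarrow> 0 \<le> \<tau> T) \<and>
     (\<forall>S\<in>A. \<forall>T\<in>A. \<tau> (S o\<^sub>L T) = \<tau> (T o\<^sub>L S))"

definition faithful_on :: "('h::chilbert_space \<Rightarrow>\<^sub>L 'h) set \<Rightarrow> (('h \<Rightarrow>\<^sub>L 'h) \<Rightarrow> complex) \<Rightarrow> bool" where
  "faithful_on A \<tau> \<longleftrightarrow> (\<forall>T\<in>A. positive_op T \<and> \<tau> T = 0 \<longrightarrow> T = 0)"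

text \<open>Normality: \<open>\<tau> (sup D) = sup (\<tau> ` D)\<close> for every upward directed family \<open>D\<close> of positive
  elements possessing a supremum in the algebra, where \<open>S \<le> T\<close> means that \<open>T - S\<close> is positive.\<close>

definition upward_directed :: "('h::chilbert_space \<Rightarrow>\<^sub>L 'h) set \<Rightarrow> bool" where
  "upward_directed D \<longleftrightarrow> D \<noteq> {} \<and>
     (\<forall>S\<in>D. \<forall>T\<in>D. \<exists>R\<in>D. positive_op (R - S) \<and> positive_op (R - T))"

definition is_sup_in :: "('h::chilbert_space \<Rightarrow>\<^sub>L 'h) set \<Rightarrow> ('h \<Rightarrow>\<^sub>L 'h) set \<Rightarrow> ('h \<Rightarrow>\<^sub>L 'h) \<Rightarrow> bool" where
  "is_sup_in A D S \<longleftrightarrow> S \<in> A \<and> (\<forall>T\<in>D. positive_op (S - T)) \<and>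
     (\<forall>R\<in>A. (\<forall>T\<in>D. positive_op (R - T)) \<longrightarrow> positive_op (R - S))"

definition normal_on :: "('h::chilbert_space \<Rightarrow>\<^sub>L 'h) set \<Rightarrow> (('h \<Rightarrow>\<^sub>L 'h) \<Rightarrow> complex) \<Rightarrow> bool" where
  "normal_on A \<tau> \<longleftrightarrow>
     (\<forall>D S. D \<subseteq> A \<and> (\<forall>T\<in>D. positive_op T) \<and> upward_directed D \<and> is_sup_in A D S \<longrightarrow>
        Re (\<tau> S) = (SUP T\<in>D. Re (\<tau> T)))"

section \<open>Matrices and maps on matrices\<close>

definition matrix_unit :: "'n \<Rightarrow> 'n \<Rightarrow> complex^'n^'n" where
  "matrix_unit i j = (\<chi> k l. if k = i \<and> l = j then 1 else 0)"

text \<open>\<open>M\<^sub>m \<otimes> M\<^sub>n\<close> is identified with the matrices indexed by pairs.\<close>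

definition kronecker ::
  "complex^'m^'m \<Rightarrow> complex^'n^'n \<Rightarrow> complex^('m \<times> 'n)^('m \<times> 'n)" where
  "kronecker A B = (\<chi> p q. A $ fst p $ fst q * B $ snd p $ snd q)"

definition choi_matrix ::
  "(complex^'n^'n \<Rightarrow> complex^'n^'n) \<Rightarrow> complex^('n::finite \<times> 'n)^('n \<times> 'n)" where
  "choi_matrix \<Phi> = (\<Sum>i\<in>UNIV. \<Sum>j\<in>UNIV. kronecker (matrix_unit i j) (\<Phi> (matrix_unit i j)))"

definition psd :: "complex^'n^'n \<Rightarrow> bool" where
  "psd A \<longleftrightarrow> (\<forall>v. 0 \<le> (\<Sum>i\<in>UNIV. \<Sum>j\<in>UNIV. cnj (v $ i) * A $ i $ j * v $ j))"

definition entrywise_nonneg :: "complex^'n^'n \<Rightarrow> bool" where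
  "entrywise_nonneg A \<longleftrightarrow> (\<forall>i j. 0 \<le> A $ i $ j)"

definition schur_map :: "complex^'n^'n \<Rightarrow> complex^'n^'n \<Rightarrow> complex^'n^'n" where
  "schur_map W X = (\<chi> i j. X $ i $ j * W $ i $ j)"

definition complex_linear_map :: "(complex^'n^'n \<Rightarrow> complex^'n^'n) \<Rightarrow> bool" where
  "complex_linear_map \<Phi> \<longleftrightarrow>
     (\<forall>X Y. \<Phi> (X + Y) = \<Phi> X + \<Phi> Y) \<and>
     (\<forall>c X. \<Phi> (\<chi> i j. c * X $ i $ j) = (\<chi> i j. c * \<Phi> X $ i $ j))"

text \<open>An element of \<open>M\<^sub>k(M\<^sub>n)\<close>, with \<open>k\<close> a natural number, is given by its blocks
  \<open>X a b\<close> for \<open>a, b < k\<close>.\<close>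

definition block_psd :: "nat \<Rightarrow> (nat \<Rightarrow> nat \<Rightarrow> complex^'n^'n) \<Rightarrow> bool" where
  "block_psd k X \<longleftrightarrow> (\<forall>v :: nat \<Rightarrow> complex^'n.
     0 \<le> (\<Sum>a<k. \<Sum>b<k. \<Sum>i\<in>UNIV. \<Sum>j\<in>UNIV. cnj (v a $ i) * X a b $ i $ j * v b $ j))"

definition completely_positive :: "(complex^'n^'n \<Rightarrow> complex^'n^'n) \<Rightarrow> bool" where
  "completely_positive \<Phi> \<longleftrightarrow>
     complex_linear_map \<Phi> \<and> (\<forall>k X. block_psd k X \<longrightarrow> block_psd k (\<lambda>a b. \<Phi> (X a b)))"

definition trace_preserving :: "(complex^'n^'n \<Rightarrow> complex^'n^'n) \<Rightarrow> bool" where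
  "trace_preserving \<Phi> \<longleftrightarrow> (\<forall>X. trace (\<Phi> X) = trace X)"

section \<open>Positive factorizability\<close>

text \<open>\<open>M\<^sub>n(\<complex>) \<otimes> \<A>\<close> is rendered as \<open>M\<^sub>n(\<A>)\<close>.\<close>

definition op_mat_mult ::
  "('h::chilbert_space \<Rightarrow>\<^sub>L 'h)^'n^'n \<Rightarrow> ('h \<Rightarrow>\<^sub>L 'h)^'n^'n \<Rightarrow> ('h \<Rightarrow>\<^sub>L 'h)^'n^'n" where
  "op_mat_mult Y Z = (\<chi> i j. \<Sum>k\<in>UNIV. Y $ i $ k o\<^sub>L Z $ k $ j)"

definition op_mat_adj :: "('h::chilbert_space \<Rightarrow>\<^sub>L 'h)^'n^'n \<Rightarrow> ('h \<Rightarrow>\<^sub>L 'h)^'n^'n" where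
  "op_mat_adj Z = (\<chi> i j. adj (Z $ j $ i))"

definition tensor_one :: "complex^'n^'n \<Rightarrow> ('h::chilbert_space \<Rightarrow>\<^sub>L 'h)^'n^'n" where
  "tensor_one X = (\<chi> i j. scalar_op (X $ i $ j))"

definition id_tensor ::
  "(('h::chilbert_space \<Rightarrow>\<^sub>L 'h) \<Rightarrow> complex) \<Rightarrow> ('h \<Rightarrow>\<^sub>L 'h)^'n^'n \<Rightarrow> complex^'n^'n" where
  "id_tensor \<tau> Z = (\<chi> i j. \<tau> (Z $ i $ j))"

text \<open>A definition cannot quantify over types, so the Hilbert space on which the von Neumann
  algebra acts is a type parameter. A map is not positively factorizable iff
  \<open>\<not> positively_factorizable TYPE('h) \<Phi>\<close> holds for every \<open>'h\<close>, i.e. as a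
  statement with a free type variable \<open>'h\<close>. The notion is meant for completely
  positive trace-preserving \<open>\<Phi>\<close>.\<close>

definition positively_factorizable ::
  "'h::chilbert_space itself \<Rightarrow> (complex^'n^'n \<Rightarrow> complex^'n^'n) \<Rightarrow> bool" where
  "positively_factorizable _ \<Phi> \<longleftrightarrow>
     (\<exists>(A :: ('h \<Rightarrow>\<^sub>L 'h) set) \<tau> (Z :: ('h \<Rightarrow>\<^sub>L 'h)^'n^'n).
        finite_von_neumann_algebra A \<and>
        finite_trace A \<tau> \<and> faithful_on A \<tau> \<and> normal_on A \<tau> \<and>
        (\<forall>i j. Z $ i $ j \<in> A \<and> positive_op (Z $ i $ j)) \<and>
        (\<forall>X. \<Phi> X = id_tensor \<tau> (op_mat_mult (op_mat_mult Z (tensor_one X)) (op_mat_adj Z))))"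

section \<open>The matrix\<close>

definition W :: "complex^5^5" where
  "W = vector
    [vector [1, complex_of_real (2 / sqrt 6), 0, 0, 1/3],
     vector [complex_of_real (2 / sqrt 6), 1, 1/2, 0, 0],
     vector [0, 1/2, 1, 1/2, 0],
     vector [0, 0, 1/2, 1, complex_of_real (2 / sqrt 6)],
     vector [1/3, 0, 0, complex_of_real (2 / sqrt 6), 1]]"

text \<open>In the index type \<^typ>\<open>5\<close> the numeral \<open>5\<close> equals \<open>0\<close>; it labels the last row and column.\<close>

lemma vector_5:
  fixes a :: "'a::zero"
  shows "(vector [a, b, c, d, e] :: 'a^5) $ 1 = a"
    and "(vector [a, b, c, d, e] :: 'a^5) $ 2 = b"
    and "(vector [a, b, c, d, e] :: 'a^5) $ 3 = c"
    and "(vector [a, b, c, d, e] :: 'a^5) $ 4 = d"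
    and "(vector [a, b, c, d, e] :: 'a^5) $ 5 = e"
  unfolding vector_def by simp_all

end

theory Submission
  imports Defs
begin

text \<open>If \<open>S\<^sub>W\<close> were positively factorizable, then the diagonal entries \<open>P\<^sub>i = Z(i,i)\<close> would be
  positive elements with \<open>\<tau> (P\<^sub>i P\<^sub>j) = W\<^sub>i\<^sub>j\<close>. A zero entry of \<open>W\<close> forces \<open>P\<^sub>i P\<^sub>j = 0\<close>, and a
  real kernel vector \<open>x\<close> of \<open>W\<close> forces \<open>\<Sum> x\<^sub>i P\<^sub>i = 0\<close>. As \<open>W\<close> has rank 3, \<open>P\<^sub>4\<close> and \<open>P\<^sub>5\<close> are
  linear combinations of \<open>P\<^sub>1\<close>, \<open>P\<^sub>2\<close>, \<open>P\<^sub>3\<close>; multiplying these relations by the \<open>P\<^sub>j\<close> that are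
  orthogonal to \<open>P\<^sub>4\<close> or \<open>P\<^sub>5\<close> gives, with \<open>\<alpha> = 2 / sqrt 6\<close>, first
  \<open>P\<^sub>1 P\<^sub>2 = P\<^sub>2 P\<^sub>1 = \<alpha> P\<^sub>1\<^sup>2\<close> and then \<open>P\<^sub>2\<^sup>2 = P\<^sub>1\<^sup>2\<close>. Hence
  \<open>P\<^sub>1\<^sup>3 = P\<^sub>2\<^sup>2 P\<^sub>1 = \<alpha>\<^sup>2 P\<^sub>1\<^sup>3\<close>, so \<open>P\<^sub>1 = 0\<close>, contradicting \<open>\<tau> (P\<^sub>1\<^sup>2) = 1\<close>. Complete
  positivity holds because \<open>W\<close> is a Gram matrix.\<close>

section \<open>Positive operators\<close>

lemma cinner_add_left: "cinner (x + y) z = cinner x z + cinner y z"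
  by (metis cinner_commute cinner_add_right complex_cnj_add)

lemma cinner_scaleC_left: "cinner (scaleC a x) y = cnj a * cinner x y"
  by (metis cinner_commute cinner_scaleC_right complex_cnj_mult)

lemma cinner_scaleR_right: "cinner x (r *\<^sub>R y) = r * cinner x y"
  by (metis cinner_scaleC_right scaleC_of_real)

lemma cinner_scaleR_left: "cinner (r *\<^sub>R x) y = r * cinner x y"
  by (metis cinner_scaleC_left scaleC_of_real complex_cnj_complex_of_real)

lemma cinner_diff_right: "cinner x (y - z) = cinner x y - cinner x z"
  using cinner_add_right[of x "y - z" z] by (simp add: algebra_simps)

lemma cinner_diff_left: "cinner (x - y) z = cinner x z - cinner y z"
  using cinner_add_left[of "x - y" y z] by (simp add: algebra_simps)

lemma cinner_zero_right [simp]: "cinner x 0 = 0"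
  using cinner_diff_right[of x 0 0] by simp

lemma cinner_zero_left [simp]: "cinner 0 x = 0"
  using cinner_diff_left[of 0 0 x] by simp

lemma cinner_self_nonneg: "0 \<le> cinner x x"
  by (simp add: cinner_self less_eq_complex_def)

lemma cinner_self_eq_0: "cinner x x = 0 \<longleftrightarrow> x = 0"
  by (simp add: cinner_self)

text \<open>Expanding the square of \<open>norm (x - y)\<close> gives this weak form of
  Cauchy-Schwarz.\<close>

lemma Re_cinner_le: "2 * Re (cinner x y) \<le> (norm x)\<^sup>2 + (norm y)\<^sup>2"
proof -
  have "cinner (x - y) (x - y) = cinner x x + cinner y y - (cinner x y + cinner y x)"
    by (simp add: cinner_diff_left cinner_diff_right)
  moreover have "Re (cinner y x) = Re (cinner x y)"
    by (subst cinner_commute) simp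
  moreover have "0 \<le> Re (cinner (x - y) (x - y))"
    using cinner_self_nonneg[of "x - y"] by (simp add: less_eq_complex_def)
  ultimately show ?thesis
    by (simp add: cinner_self)
qed

text \<open>Symmetry of the form is used rather than \<open>adj T = T\<close>, because
  \<open>adj\<close> is a definite description whose value must first be identified.\<close>

definition self_adjoint :: "('h::chilbert_space \<Rightarrow>\<^sub>L 'h) \<Rightarrow> bool" where
  "self_adjoint T \<longleftrightarrow> (\<forall>x y. cinner (blinfun_apply T x) y = cinner x (blinfun_apply T y))"

lemma self_adjointD: "self_adjoint T \<Longrightarrow> cinner (blinfun_apply T x) y = cinner x (blinfun_apply T y)"
  by (simp add: self_adjoint_def)

lemma self_adjoint_add: "self_adjoint S \<Longrightarrow> self_adjoint T \<Longrightarrow> self_adjoint (S + T)"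
  by (simp add: self_adjoint_def cinner_add_left cinner_add_right blinfun.add_left)

lemma self_adjoint_scaleR: "self_adjoint T \<Longrightarrow> self_adjoint (r *\<^sub>R T)"
  by (simp add: self_adjoint_def cinner_scaleR_left cinner_scaleR_right blinfun.scaleR_left)

lemma positive_op_bounded: "positive_op T \<Longrightarrow> T \<in> bounded_ops"
  by (simp add: positive_op_def)

text \<open>Polarization: the defect \<open>D\<close> vanishes on the diagonal because
  \<open>cinner z (T z)\<close> is real, and its values at \<open>x + y\<close> and
  \<open>x + scaleC \<i> y\<close> then force \<open>D x y = 0\<close>.\<close>

lemma positive_op_self_adjoint:
  assumes "positive_op T"
  shows "self_adjoint T"
  unfolding self_adjoint_def
proof (intro allI)
  fix x y
  let ?T = "blinfun_apply T"
  define D where "D x y = cinner (?T x) y - cinner x (?T y)" for x y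
  have DT: "?T (scaleC c z) = scaleC c (?T z)" for c z
    using assms by (simp add: positive_op_def bounded_ops_def)
  have D0: "D z z = 0" for z
  proof -
    have "0 \<le> cinner z (?T z)"
      using assms by (simp add: positive_op_def)
    then have "cnj (cinner z (?T z)) = cinner z (?T z)"
      by (simp add: less_eq_complex_def complex_eq_iff)
    then show ?thesis
      unfolding D_def by (metis cinner_commute diff_self)
  qed
  have "D (x + y) (x + y) = D x x + D y y + (D x y + D y x)"
    by (simp add: D_def cinner_add_left cinner_add_right blinfun.add_right)
  then have "D x y + D y x = 0"
    by (simp add: D0)
  moreover have "D (x + scaleC \<i> y) (x + scaleC \<i> y) = D x x + D y y + \<i> * (D x y - D y x)"
    by (simp add: D_def cinner_add_left cinner_add_right blinfun.add_right DT
        cinner_scaleC_left cinner_scaleC_right algebra_simps)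
  then have "D x y - D y x = 0"
    by (simp add: D0)
  ultimately have "D x y = 0"
    by simp
  then show "cinner (?T x) y = cinner x (?T y)"
    by (simp add: D_def)
qed

text \<open>\<open>T\<close> itself meets the description, and for any candidate \<open>S\<close>
  the vector \<open>(S - T) x\<close> is orthogonal to itself.\<close>

lemma adj_positive_op:
  assumes "positive_op T"
  shows "adj T = T"
  unfolding adj_def
proof (rule the_equality)
  show "T \<in> bounded_ops \<and> (\<forall>x y. cinner (blinfun_apply T x) y = cinner x (blinfun_apply T y))"
    using positive_op_bounded[OF assms] positive_op_self_adjoint[OF assms]
    by (simp add: self_adjoint_def)
next
  fix S
  assume "S \<in> bounded_ops \<and> (\<forall>x y. cinner (blinfun_apply S x) y = cinner x (blinfun_apply T y))"
  then have S: "cinner (blinfun_apply S x) y = cinner (blinfun_apply T x) y" for x y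
    using positive_op_self_adjoint[OF assms] by (simp add: self_adjoint_def)
  show "S = T"
  proof (rule blinfun_eqI)
    fix x
    let ?d = "blinfun_apply S x - blinfun_apply T x"
    have "cinner ?d ?d = 0"
      by (simp add: cinner_diff_left[of "blinfun_apply S x"] S)
    then show "blinfun_apply S x = blinfun_apply T x"
      by (simp add: cinner_self_eq_0)
  qed
qed

section \<open>Closure and order rules for operators\<close>

lemma compose_assoc: "(R o\<^sub>L S) o\<^sub>L T = R o\<^sub>L (S o\<^sub>L (T :: _ \<Rightarrow>\<^sub>L _))"
  by (rule blinfun_eqI) simp

lemma scaleR_eq_scalar_op: "r *\<^sub>R T = scalar_op (complex_of_real r) o\<^sub>L T"
  by (rule blinfun_eqI) (simp add: blinfun.scaleR_left scalar_op.rep_eq scaleC_of_real)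

lemma bounded_ops_compose: "S \<in> bounded_ops \<Longrightarrow> T \<in> bounded_ops \<Longrightarrow> S o\<^sub>L T \<in> bounded_ops"
  by (simp add: bounded_ops_def)

lemma scaleC_diff_right: "scaleC c (x - y) = scaleC c x - scaleC c y"
  using scaleC_add_right[of c "x - y" y] by (simp add: algebra_simps)

lemma bounded_ops_diff: "S \<in> bounded_ops \<Longrightarrow> T \<in> bounded_ops \<Longrightarrow> S - T \<in> bounded_ops"
  by (simp add: bounded_ops_def blinfun.diff_left scaleC_diff_right)

lemma bounded_ops_scaleR: "T \<in> bounded_ops \<Longrightarrow> r *\<^sub>R T \<in> bounded_ops"
  by (simp add: bounded_ops_def blinfun.scaleR_left scaleC_of_real[symmetric] scaleC_scaleC
      mult.commute)

lemma bounded_ops_id: "id_blinfun \<in> bounded_ops"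
  by (simp add: bounded_ops_def)

lemma positive_op_add: "positive_op S \<Longrightarrow> positive_op T \<Longrightarrow> positive_op (S + T)"
  by (simp add: positive_op_def bounded_ops_def blinfun.add_left scaleC_add_right cinner_add_right)

lemma positive_op_scaleR: "positive_op T \<Longrightarrow> 0 \<le> r \<Longrightarrow> positive_op (r *\<^sub>R T)"
  by (simp add: positive_op_def bounded_ops_scaleR blinfun.scaleR_left cinner_scaleR_right
      less_eq_complex_def)

lemma positive_op_conjugate:
  assumes "S \<in> bounded_ops" "self_adjoint S" "positive_op T"
  shows "positive_op (S o\<^sub>L T o\<^sub>L S)"
  using assms by (simp add: positive_op_def bounded_ops_compose self_adjointD[symmetric])

lemma positive_op_square:
  assumes "S \<in> bounded_ops" "self_adjoint S"
  shows "positive_op (S o\<^sub>L S)"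
  unfolding positive_op_def
proof (intro conjI allI)
  show "S o\<^sub>L S \<in> bounded_ops"
    using assms(1) by (simp add: bounded_ops_compose)
  show "0 \<le> cinner x (blinfun_apply (S o\<^sub>L S) x)" for x
    using self_adjointD[OF assms(2), of x "blinfun_apply S x"]
      cinner_self_nonneg[of "blinfun_apply S x"] by simp
qed

lemma self_adjoint_square_eq_0:
  assumes "self_adjoint T" "T o\<^sub>L T = 0"
  shows "T = 0"
proof (rule blinfun_eqI)
  fix x
  have "cinner (blinfun_apply T x) (blinfun_apply T x) = cinner x (blinfun_apply (T o\<^sub>L T) x)"
    using assms(1) by (simp add: self_adjointD)
  then show "blinfun_apply T x = blinfun_apply 0 x"
    by (simp add: assms(2) cinner_self_eq_0)
qed

lemma positive_op_id_diff:
  assumes "positive_op T" "norm T \<le> 1"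
  shows "positive_op (id_blinfun - T)"
  unfolding positive_op_def
proof (intro conjI allI)
  show "id_blinfun - T \<in> bounded_ops"
    using assms(1) by (simp add: bounded_ops_diff bounded_ops_id positive_op_bounded)
next
  fix x
  let ?y = "blinfun_apply T x"
  have "norm ?y \<le> norm T * norm x"
    by (rule norm_blinfun)
  also have "\<dots> \<le> norm x"
    using assms(2) by (simp add: mult_left_le_one_le)
  finally have "(norm ?y)\<^sup>2 \<le> (norm x)\<^sup>2"
    by (simp add: power_mono)
  then have "Re (cinner x ?y) \<le> (norm x)\<^sup>2"
    using Re_cinner_le[of x ?y] by linarith
  moreover have "0 \<le> cinner x ?y"
    using assms(1) by (simp add: positive_op_def)
  ultimately show "0 \<le> cinner x (blinfun_apply (id_blinfun - T) x)"
    by (simp add: blinfun.diff_left cinner_diff_right cinner_self less_eq_complex_def)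
qed

text \<open>The identity behind this is \<open>C - C\<^sup>2 = (1 - C) C (1 - C) + C (1 - C) C\<close>.\<close>

lemma positive_op_diff_square:
  assumes C: "positive_op C" and C1: "positive_op (id_blinfun - C)"
  shows "positive_op (C - (C o\<^sub>L C))"
proof -
  let ?D = "id_blinfun - C"
  have "C - (C o\<^sub>L C) = (?D o\<^sub>L C o\<^sub>L ?D) + (C o\<^sub>L ?D o\<^sub>L C)"
    by (rule blinfun_eqI)
      (simp add: blinfun.diff_left blinfun.diff_right blinfun.add_left blinfun.add_right)
  moreover have "positive_op ((?D o\<^sub>L C o\<^sub>L ?D) + (C o\<^sub>L ?D o\<^sub>L C))"
    by (intro positive_op_add positive_op_conjugate positive_op_bounded positive_op_self_adjoint
        C C1)
  ultimately show ?thesis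
    by simp
qed

section \<open>Faithful traces\<close>

locale faithful_trace =
  fixes A :: "('h::chilbert_space \<Rightarrow>\<^sub>L 'h) set" and \<tau> :: "('h \<Rightarrow>\<^sub>L 'h) \<Rightarrow> complex"
  assumes alg: "unital_star_subalgebra A" and tr: "finite_trace A \<tau>" and faithful: "faithful_on A \<tau>"
begin

section \<open>Calculus in the algebra and under the trace\<close>

lemma in_bounded: "T \<in> A \<Longrightarrow> T \<in> bounded_ops"
  using alg by (auto simp: unital_star_subalgebra_def)

lemma id_in: "id_blinfun \<in> A"
  and add_in: "S \<in> A \<Longrightarrow> T \<in> A \<Longrightarrow> S + T \<in> A"
  and compose_in: "S \<in> A \<Longrightarrow> T \<in> A \<Longrightarrow> S o\<^sub>L T \<in> A"
  using alg by (auto simp: unital_star_subalgebra_def)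

lemma scaleR_in: "T \<in> A \<Longrightarrow> r *\<^sub>R T \<in> A"
  using alg by (simp add: unital_star_subalgebra_def scaleR_eq_scalar_op)

lemma diff_in: "S \<in> A \<Longrightarrow> T \<in> A \<Longrightarrow> S - T \<in> A"
  using add_in[of S "(-1) *\<^sub>R T"] scaleR_in[of T "-1"] by simp

lemma trace_add: "S \<in> A \<Longrightarrow> T \<in> A \<Longrightarrow> \<tau> (S + T) = \<tau> S + \<tau> T"
  and trace_compose_commute: "S \<in> A \<Longrightarrow> T \<in> A \<Longrightarrow> \<tau> (S o\<^sub>L T) = \<tau> (T o\<^sub>L S)"
  and trace_nonneg: "T \<in> A \<Longrightarrow> positive_op T \<Longrightarrow> 0 \<le> \<tau> T"
  using tr by (auto simp: finite_trace_def)

lemma trace_scaleR: "T \<in> A \<Longrightarrow> \<tau> (r *\<^sub>R T) = r * \<tau> T"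
  using tr by (simp add: finite_trace_def scaleR_eq_scalar_op)

lemma trace_diff: "S \<in> A \<Longrightarrow> T \<in> A \<Longrightarrow> \<tau> (S - T) = \<tau> S - \<tau> T"
  using trace_add[of "S - T" T] diff_in[of S T] by simp

lemma trace_square_nonneg: "T \<in> A \<Longrightarrow> self_adjoint T \<Longrightarrow> 0 \<le> \<tau> (T o\<^sub>L T)"
  by (simp add: compose_in in_bounded positive_op_square trace_nonneg)

lemma trace_square_eq_0:
  assumes "T \<in> A" "self_adjoint T" "\<tau> (T o\<^sub>L T) = 0"
  shows "T = 0"
proof -
  have "positive_op (T o\<^sub>L T)"
    using assms by (simp add: in_bounded positive_op_square)
  then have "T o\<^sub>L T = 0"
    using faithful assms by (simp add: faithful_on_def compose_in)
  then show ?thesis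
    using assms(2) self_adjoint_square_eq_0 by blast
qed

text \<open>The iteration \<open>C\<^sub>0 = C\<close>, \<open>C\<^sub>k\<^sub>+\<^sub>1 = C\<^sub>k - C\<^sub>k\<^sup>2\<close> replaces the square root of \<open>C\<close>: it
  gives \<open>C = C\<^sub>0\<^sup>2 + \<dots> + C\<^sub>n\<^sub>-\<^sub>1\<^sup>2 + C\<^sub>n\<close>, where \<open>\<tau> (C\<^sub>n\<^sup>2)\<close> tends to 0 because
  \<open>\<tau> (C\<^sub>0\<^sup>2) + \<dots> + \<tau> (C\<^sub>n\<^sub>-\<^sub>1\<^sup>2) \<le> \<tau> C\<close>.\<close>

lemma trace_conjugate_le:
  assumes S: "S \<in> A" "positive_op S"
    and C: "C \<in> A" "positive_op C" "positive_op (id_blinfun - C)"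
  shows "Re (\<tau> (C o\<^sub>L S o\<^sub>L C)) \<le> Re (\<tau> (S o\<^sub>L C))"
proof -
  define c where "c n = ((\<lambda>T. T - (T o\<^sub>L T)) ^^ n) C" for n
  have c0: "c 0 = C" and cSuc: "c (Suc n) = c n - (c n o\<^sub>L c n)" for n
    by (simp_all add: c_def)
  have c: "c n \<in> A \<and> positive_op (c n) \<and> positive_op (id_blinfun - c n)" for n
  proof (induction n)
    case 0
    then show ?case
      using C by (simp add: c0)
  next
    case (Suc n)
    have "id_blinfun - c (Suc n) = (id_blinfun - c n) + (c n o\<^sub>L c n)"
      by (simp add: cSuc)
    moreover have "positive_op (c n o\<^sub>L c n)"
      using Suc.IH by (simp add: in_bounded positive_op_self_adjoint positive_op_square)
    ultimately have "positive_op (id_blinfun - c (Suc n))"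
      using Suc.IH by (simp only: positive_op_add)
    moreover have "c (Suc n) \<in> A \<and> positive_op (c (Suc n))"
      using Suc.IH by (simp add: cSuc diff_in compose_in positive_op_diff_square)
    ultimately show ?case
      by blast
  qed
  then have cA: "c n \<in> A" and cpos: "positive_op (c n)" and csa: "self_adjoint (c n)" for n
    by (simp_all add: positive_op_self_adjoint)
  define g where "g n = Re (\<tau> (c n o\<^sub>L c n))" for n
  have g0: "0 \<le> g n" for n
    using trace_square_nonneg[OF cA csa] by (simp add: g_def less_eq_complex_def)
  have "(\<Sum>k<n. g k) = Re (\<tau> C) - Re (\<tau> (c n))" for n
    by (induction n) (simp_all add: c0 cSuc trace_diff cA compose_in g_def)
  then have "(\<Sum>k<n. g k) \<le> Re (\<tau> C)" for n
    using trace_nonneg[OF cA cpos, of n] by (simp add: less_eq_complex_def)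
  then have "summable g"
    using g0 by (intro summableI_nonneg_bounded)
  then have glim: "g \<longlonglongrightarrow> 0"
    by (rule summable_LIMSEQ_zero)
  define f where "f n = Re (\<tau> (S o\<^sub>L c n))" for n
  define h where "h n = Re (\<tau> (c n o\<^sub>L S o\<^sub>L c n))" for n
  have h0: "0 \<le> h n" for n
  proof -
    have "0 \<le> \<tau> (c n o\<^sub>L S o\<^sub>L c n)"
      by (intro trace_nonneg positive_op_conjugate compose_in in_bounded cA csa S)
    then show ?thesis
      by (simp add: h_def less_eq_complex_def)
  qed
  have fSuc: "f (Suc n) = f n - h n" for n
  proof -
    have "S o\<^sub>L c (Suc n) = (S o\<^sub>L c n) - ((S o\<^sub>L c n) o\<^sub>L c n)"
      by (rule blinfun_eqI) (simp add: cSuc blinfun.diff_left blinfun.diff_right)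
    moreover have "\<tau> ((S o\<^sub>L c n) o\<^sub>L c n) = \<tau> (c n o\<^sub>L S o\<^sub>L c n)"
      using trace_compose_commute[of "S o\<^sub>L c n" "c n"]
      by (simp add: cA S compose_in compose_assoc)
    ultimately show ?thesis
      by (simp add: f_def h_def trace_diff compose_in cA S)
  qed
  have fle: "f (Suc n) \<le> f 0 - h 0" for n
  proof (induction n)
    case 0
    then show ?case by (simp add: fSuc)
  next
    case (Suc n)
    then show ?case using fSuc[of "Suc n"] h0[of "Suc n"] by linarith
  qed
  \<comment> \<open>The claim is that the gap \<open>s\<close> is nonnegative. In this proof
    \<alpha> names the trace of the square of \<open>S\<close>, not 2 / sqrt 6.\<close>
  define s where "s = f 0 - h 0"
  define \<alpha> where "\<alpha> = Re (\<tau> (S o\<^sub>L S))"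
  have \<alpha>0: "0 \<le> \<alpha>"
    using trace_square_nonneg[OF S(1) positive_op_self_adjoint[OF S(2)]]
    by (simp add: \<alpha>_def less_eq_complex_def)
  \<comment> \<open>The trace of the square of \<open>t *\<^sub>R S + c (Suc n)\<close> is
    nonnegative, and \<open>fle\<close> bounds its cross term by \<open>2 * t * s\<close>.\<close>
  have key: "- (2 * t * s + t\<^sup>2 * \<alpha>) \<le> g (Suc n)" if t: "0 < t" for t n
  proof -
    let ?R = "t *\<^sub>R S + c (Suc n)"
    have "0 \<le> \<tau> (?R o\<^sub>L ?R)"
      by (intro trace_square_nonneg add_in scaleR_in self_adjoint_add self_adjoint_scaleR
          positive_op_self_adjoint S cA cpos)
    moreover have "?R o\<^sub>L ?R = (t\<^sup>2 *\<^sub>R (S o\<^sub>L S) + t *\<^sub>R (S o\<^sub>L c (Suc n))) +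
        (t *\<^sub>R (c (Suc n) o\<^sub>L S) + (c (Suc n) o\<^sub>L c (Suc n)))"
      by (rule blinfun_eqI)
        (simp add: blinfun.add_left blinfun.add_right blinfun.scaleR_left blinfun.scaleR_right
          power2_eq_square scaleR_add_right)
    moreover have "\<tau> (c (Suc n) o\<^sub>L S) = \<tau> (S o\<^sub>L c (Suc n))"
      by (rule trace_compose_commute[OF cA S(1)])
    ultimately have "0 \<le> t\<^sup>2 * \<alpha> + 2 * (t * f (Suc n)) + g (Suc n)"
      by (simp add: trace_add trace_scaleR add_in scaleR_in compose_in S cA \<alpha>_def f_def g_def
          less_eq_complex_def)
    moreover have "t * f (Suc n) \<le> t * s"
      using fle t by (simp add: s_def)
    ultimately show ?thesis
      by linarith
  qed
  \<comment> \<open>The term \<open>g (Suc n)\<close> tends to 0, which removes \<open>n\<close>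
    from the bound.\<close>
  have lim: "- (2 * t * s + t\<^sup>2 * \<alpha>) \<le> 0" if "0 < t" for t
    using key[OF that] LIMSEQ_Suc[OF glim] by (intro LIMSEQ_le_const) auto
  have "0 \<le> t * (2 * s + t * \<alpha>)" if "0 < t" for t
    using lim[OF that] by (simp add: algebra_simps power2_eq_square)
  then have st: "0 \<le> 2 * s + t * \<alpha>" if "0 < t" for t
    using that by (meson zero_le_mult_iff not_le)
  have "0 \<le> s"
  proof (rule ccontr)
    assume "\<not> 0 \<le> s"
    \<comment> \<open>This value of \<open>t\<close> makes \<open>2 * s + t * \<alpha>\<close>
      negative; the added 1 covers \<alpha> = 0.\<close>
    then have "0 < - s / (\<alpha> + 1)"
      using \<alpha>0 by (simp add: divide_simps)
    moreover have "\<alpha> * s \<le> 0"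
      using \<alpha>0 \<open>\<not> 0 \<le> s\<close> by (simp add: mult_nonneg_nonpos)
    then have "- s / (\<alpha> + 1) * \<alpha> < - s * 2"
      using \<alpha>0 \<open>\<not> 0 \<le> s\<close> by (simp add: field_simps)
    ultimately show False
      using st[of "- s / (\<alpha> + 1)"] by linarith
  qed
  then show ?thesis
    by (simp add: s_def f_def h_def c0)
qed

text \<open>\<open>trace_conjugate_le\<close> and faithfulness give TST = 0, so the form of
  \<open>S\<close> vanishes at y = T x. As \<open>S\<close> is a positive contraction, its square is
  at most \<open>S\<close>, hence S y = 0.\<close>

lemma trace_compose_eq_0_contraction:
  assumes S: "S \<in> A" "positive_op S" "positive_op (id_blinfun - S)"
    and T: "T \<in> A" "positive_op T" "positive_op (id_blinfun - T)"
    and eq0: "\<tau> (S o\<^sub>L T) = 0"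
  shows "S o\<^sub>L T = 0"
proof (rule blinfun_eqI)
  fix x
  have pos: "positive_op (T o\<^sub>L S o\<^sub>L T)"
    by (intro positive_op_conjugate in_bounded positive_op_self_adjoint S T)
  then have "0 \<le> \<tau> (T o\<^sub>L S o\<^sub>L T)"
    by (intro trace_nonneg compose_in S T)
  moreover have "Re (\<tau> (T o\<^sub>L S o\<^sub>L T)) \<le> 0"
    using trace_conjugate_le[OF S(1,2) T] eq0 by simp
  ultimately have "\<tau> (T o\<^sub>L S o\<^sub>L T) = 0"
    by (simp add: less_eq_complex_def complex_eq_iff)
  then have TST: "T o\<^sub>L S o\<^sub>L T = 0"
    using faithful pos by (simp add: faithful_on_def compose_in S T)
  let ?y = "blinfun_apply T x" and ?S = "blinfun_apply S"
  have "cinner ?y (?S ?y) = cinner x (blinfun_apply (T o\<^sub>L S o\<^sub>L T) x)"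
    using positive_op_self_adjoint[OF T(2)] by (simp add: self_adjointD)
  then have "cinner ?y (?S ?y) = 0"
    by (simp add: TST)
  moreover have "0 \<le> cinner ?y (blinfun_apply (S - (S o\<^sub>L S)) ?y)"
    using positive_op_diff_square[OF S(2,3)] unfolding positive_op_def by blast
  moreover have "cinner ?y (?S (?S ?y)) = cinner (?S ?y) (?S ?y)"
    using positive_op_self_adjoint[OF S(2)] by (simp add: self_adjointD)
  ultimately have "(norm (?S ?y))\<^sup>2 \<le> 0"
    by (simp add: blinfun.diff_left cinner_diff_right cinner_self less_eq_complex_def)
  then show "blinfun_apply (S o\<^sub>L T) x = blinfun_apply 0 x"
    by simp
qed

lemma trace_compose_eq_0:
  assumes S: "S \<in> A" "positive_op S" and T: "T \<in> A" "positive_op T"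
    and eq0: "\<tau> (S o\<^sub>L T) = 0"
  shows "S o\<^sub>L T = 0"
proof -
  \<comment> \<open>Positive scaling reduces to contractions; adding 1 keeps the factor positive at
    R = 0.\<close>
  define n where "n R = inverse (norm R + 1)" for R :: "'h \<Rightarrow>\<^sub>L 'h"
  have n0: "0 < n R" for R
    unfolding n_def by (simp add: add_nonneg_pos)
  have scaled: "n R *\<^sub>R R \<in> A \<and> positive_op (n R *\<^sub>R R) \<and> positive_op (id_blinfun - n R *\<^sub>R R)"
    if "R \<in> A" "positive_op R" for R
  proof -
    have "norm (n R *\<^sub>R R) \<le> 1"
      unfolding n_def by (simp add: divide_simps add_nonneg_pos)
    moreover have "positive_op (n R *\<^sub>R R)"
      using that n0[of R] by (simp add: positive_op_scaleR)
    ultimately show ?thesis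
      using that by (simp add: scaleR_in positive_op_id_diff)
  qed
  have eq: "(n S *\<^sub>R S) o\<^sub>L (n T *\<^sub>R T) = (n S * n T) *\<^sub>R (S o\<^sub>L T)"
    by (rule blinfun_eqI) (simp add: blinfun.scaleR_left blinfun.scaleR_right)
  have "(n S *\<^sub>R S) o\<^sub>L (n T *\<^sub>R T) = 0"
    using scaled[OF S] scaled[OF T]
    by (intro trace_compose_eq_0_contraction) (simp_all add: eq trace_scaleR compose_in S T eq0)
  then show ?thesis
    using n0[of S] n0[of T] by (simp add: eq)
qed

lemma sum_in: "(\<And>i. i \<in> I \<Longrightarrow> T i \<in> A) \<Longrightarrow> sum T I \<in> A"
  and trace_sum: "(\<And>i. i \<in> I \<Longrightarrow> T i \<in> A) \<Longrightarrow> \<tau> (sum T I) = (\<Sum>i\<in>I. \<tau> (T i))"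
proof -
  \<comment> \<open>These cover the empty index set and the infinite one, where the sum is 0 by
    default.\<close>
  have zero: "0 \<in> A" "\<tau> 0 = 0"
    using diff_in[OF id_in id_in] trace_diff[OF id_in id_in] by simp_all
  have "sum T I \<in> A \<and> \<tau> (sum T I) = (\<Sum>i\<in>I. \<tau> (T i))" if "\<And>i. i \<in> I \<Longrightarrow> T i \<in> A"
    using that by (induction I rule: infinite_finite_induct) (simp_all add: zero add_in trace_add)
  then show "(\<And>i. i \<in> I \<Longrightarrow> T i \<in> A) \<Longrightarrow> sum T I \<in> A"
    and "(\<And>i. i \<in> I \<Longrightarrow> T i \<in> A) \<Longrightarrow> \<tau> (sum T I) = (\<Sum>i\<in>I. \<tau> (T i))"
    by blast+
qed

text \<open>The kernel relation says that the combination R has trace product 0 with every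
  \<open>P i\<close>. By linearity R has it with itself, and faithfulness applies.\<close>

lemma gram_kernel:
  fixes P :: "'i \<Rightarrow> 'h \<Rightarrow>\<^sub>L 'h" and x :: "'i \<Rightarrow> real"
  assumes PA: "\<And>i. i \<in> I \<Longrightarrow> P i \<in> A" and sa: "\<And>i. i \<in> I \<Longrightarrow> self_adjoint (P i)"
    and ker: "\<And>i. i \<in> I \<Longrightarrow> (\<Sum>j\<in>I. x j * \<tau> (P j o\<^sub>L P i)) = 0"
  shows "(\<Sum>j\<in>I. x j *\<^sub>R P j) = 0" (is "?R = 0")
proof (rule trace_square_eq_0)
  interpret comp: bounded_bilinear "(o\<^sub>L) :: ('h \<Rightarrow>\<^sub>L 'h) \<Rightarrow> ('h \<Rightarrow>\<^sub>L 'h) \<Rightarrow> ('h \<Rightarrow>\<^sub>L 'h)"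
    by (rule bounded_bilinear_blinfun_compose)
  show RA: "?R \<in> A"
    by (simp add: sum_in scaleR_in PA)
  show "self_adjoint ?R"
    using sa by (induction I rule: infinite_finite_induct)
      (simp_all add: self_adjoint_add self_adjoint_scaleR, simp_all add: self_adjoint_def)
  have *: "\<tau> (?R o\<^sub>L P i) = 0" if "i \<in> I" for i
    using ker[OF that] that
    by (simp add: comp.sum_left comp.scaleR_left trace_sum trace_scaleR scaleR_in compose_in PA)
  have "?R o\<^sub>L ?R = (\<Sum>i\<in>I. x i *\<^sub>R (?R o\<^sub>L P i))"
    by (simp only: comp.sum_right[of ?R] comp.scaleR_right)
  also have "\<tau> \<dots> = 0"
    by (simp add: trace_sum trace_scaleR scaleR_in compose_in PA RA *)
  finally show "\<tau> (?R o\<^sub>L ?R) = 0" .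
qed

end

section \<open>Schur product maps\<close>

text \<open>The quadratic form is a weighted sum of squared moduli. The weights \<open>d\<close>
  keep square roots of pivots out of the factors \<open>g\<close>.\<close>

lemma psd_factored:
  fixes V :: "complex^'n^'n" and R :: "'r set"
  assumes V: "\<And>i j. V $ i $ j = (\<Sum>r\<in>R. of_real (d r) * (cnj (g r i) * g r j))"
    and d: "\<And>r. r \<in> R \<Longrightarrow> 0 \<le> d r"
  shows "psd V"
  unfolding psd_def
proof
  fix v
  have "(\<Sum>i\<in>UNIV. \<Sum>j\<in>UNIV. cnj (v $ i) * V $ i $ j * v $ j) =
      (\<Sum>r\<in>R. of_real (d r) * (cnj (\<Sum>i\<in>UNIV. g r i * v $ i) * (\<Sum>j\<in>UNIV. g r j * v $ j)))"
    by (simp add: V sum_distrib_left sum_distrib_right sum.swap[where B = R] sum_product ac_simps)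
  also have "0 \<le> \<dots>"
  proof (rule sum_nonneg, rule mult_nonneg_nonneg)
    show "0 \<le> complex_of_real (d r)" if "r \<in> R" for r
      using d[OF that] by (simp add: less_eq_complex_def)
    show "0 \<le> cnj z * z" for z
      by (metis cinner_complex_def cinner_self_nonneg)
  qed
  finally show "0 \<le> (\<Sum>i\<in>UNIV. \<Sum>j\<in>UNIV. cnj (v $ i) * V $ i $ j * v $ j)" .
qed

text \<open>Each summand of \<open>V\<close> can be absorbed into the test vectors, so the form of
  the image is a weighted sum of forms of \<open>X\<close> at the vectors
  \<open>w r\<close>.\<close>

lemma completely_positive_schur_map_factored:
  fixes V :: "complex^'n^'n" and R :: "'r set"
  assumes V: "\<And>i j. V $ i $ j = (\<Sum>r\<in>R. of_real (d r) * (cnj (g r i) * g r j))"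
    and d: "\<And>r. r \<in> R \<Longrightarrow> 0 \<le> d r"
  shows "completely_positive (schur_map V)"
  unfolding completely_positive_def
proof (intro conjI allI impI)
  show "complex_linear_map (schur_map V)"
    by (simp add: complex_linear_map_def schur_map_def vec_eq_iff algebra_simps)
next
  fix k and X :: "nat \<Rightarrow> nat \<Rightarrow> complex^'n^'n"
  assume X: "block_psd k X"
  show "block_psd k (\<lambda>a b. schur_map V (X a b))"
    unfolding block_psd_def
  proof
    fix v :: "nat \<Rightarrow> complex^'n"
    define w where "w r a = (\<chi> i. g r i * v a $ i)" for r a
    have "(\<Sum>a<k. \<Sum>b<k. \<Sum>i\<in>UNIV. \<Sum>j\<in>UNIV.
          cnj (v a $ i) * schur_map V (X a b) $ i $ j * v b $ j) =
        (\<Sum>r\<in>R. of_real (d r) * (\<Sum>a<k. \<Sum>b<k. \<Sum>i\<in>UNIV. \<Sum>j\<in>UNIV.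
          cnj (w r a $ i) * X a b $ i $ j * w r b $ j))"
      by (simp add: schur_map_def V w_def sum_distrib_left sum_distrib_right
          sum.swap[where B = R] ac_simps)
    also have "0 \<le> \<dots>"
    proof (rule sum_nonneg, rule mult_nonneg_nonneg)
      show "0 \<le> complex_of_real (d r)" if "r \<in> R" for r
        using d[OF that] by (simp add: less_eq_complex_def)
    qed (use X in \<open>simp only: block_psd_def\<close>)
    finally show "0 \<le> (\<Sum>a<k. \<Sum>b<k. \<Sum>i\<in>UNIV. \<Sum>j\<in>UNIV.
          cnj (v a $ i) * schur_map V (X a b) $ i $ j * v b $ j)" .
  qed
qed

text \<open>The (i, j) summand has its only possibly nonzero entry at row (i, i) and column (j,
  j).\<close>

lemma choi_matrix_schur_map:
  "choi_matrix (schur_map V) $ p $ q =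
    (if fst p = snd p \<and> fst q = snd q then V $ fst p $ fst q else 0)"
proof -
  define c where "c = (if fst p = snd p \<and> fst q = snd q then V $ fst p $ fst q else 0)"
  have "kronecker (matrix_unit i j) (schur_map V (matrix_unit i j)) $ p $ q =
      (if i = fst p then if j = fst q then c else 0 else 0)" for i j
    by (auto simp: kronecker_def matrix_unit_def schur_map_def c_def)
  then have "choi_matrix (schur_map V) $ p $ q =
      (\<Sum>i\<in>UNIV. \<Sum>j\<in>UNIV. if i = fst p then if j = fst q then c else 0 else 0)"
    by (simp add: choi_matrix_def)
  also have "\<dots> = (\<Sum>i\<in>UNIV. if i = fst p then c else 0)"
    by (intro sum.cong refl) simp
  also have "\<dots> = c"
    by simp
  finally show ?thesis
    by (simp only: c_def)
qed

text \<open>Extending the factors of \<open>V\<close> by zero off the pairs (i, i) factors the Choi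
  matrix with the same weights.\<close>

lemma psd_choi_matrix_schur_map_factored:
  fixes V :: "complex^'n^'n" and R :: "'r set"
  assumes V: "\<And>i j. V $ i $ j = (\<Sum>r\<in>R. of_real (d r) * (cnj (g r i) * g r j))"
    and d: "\<And>r. r \<in> R \<Longrightarrow> 0 \<le> d r"
  shows "psd (choi_matrix (schur_map V))"
proof (rule psd_factored[where R = R and d = d])
  show "choi_matrix (schur_map V) $ p $ q = (\<Sum>r\<in>R. of_real (d r) *
      (cnj (if fst p = snd p then g r (fst p) else 0) * (if fst q = snd q then g r (fst q) else 0)))"
    for p q
    by (cases "fst p = snd p"; cases "fst q = snd q") (simp_all add: choi_matrix_schur_map V)
qed (rule d)

text \<open>Comparing the \<open>(i, j)\<close> entries at \<open>X = E\<^sub>i\<^sub>j\<close> isolates \<open>\<tau> (Z(i,i) Z(j,j))\<close>.\<close>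

lemma schur_map_factorization_diagonal:
  fixes Z :: "('h::chilbert_space \<Rightarrow>\<^sub>L 'h)^'n^'n"
  assumes eq: "\<And>X. schur_map V X =
      id_tensor \<tau> (op_mat_mult (op_mat_mult Z (tensor_one X)) (op_mat_adj Z))"
    and pos: "\<And>i j. positive_op (Z $ i $ j)"
  shows "\<tau> (Z $ i $ i o\<^sub>L Z $ j $ j) = V $ i $ j"
proof -
  have sc: "scalar_op 0 = (0 :: 'h \<Rightarrow>\<^sub>L 'h)" "scalar_op 1 = (id_blinfun :: 'h \<Rightarrow>\<^sub>L 'h)"
    using scaleC_of_real[of 0] scaleC_of_real[of 1]
    by (auto intro!: blinfun_eqI simp: scalar_op.rep_eq)
  have "(\<Sum>l\<in>UNIV. (\<Sum>k\<in>UNIV. Z $ i $ k o\<^sub>L scalar_op (matrix_unit i j $ k $ l)) o\<^sub>L adj (Z $ j $ l)) =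
      (\<Sum>l\<in>UNIV. if l = j then Z $ i $ i o\<^sub>L Z $ j $ j else 0)"
  proof (intro sum.cong refl)
    fix l
    have "(\<Sum>k\<in>UNIV. Z $ i $ k o\<^sub>L scalar_op (matrix_unit i j $ k $ l)) =
        (\<Sum>k\<in>UNIV. if k = i then if l = j then Z $ i $ i else 0 else 0)"
      by (intro sum.cong refl) (auto simp: matrix_unit_def sc intro!: blinfun_eqI)
    then show "(\<Sum>k\<in>UNIV. Z $ i $ k o\<^sub>L scalar_op (matrix_unit i j $ k $ l)) o\<^sub>L adj (Z $ j $ l) =
        (if l = j then Z $ i $ i o\<^sub>L Z $ j $ j else 0)"
      by (simp add: adj_positive_op pos)
  qed
  then have "\<tau> (Z $ i $ i o\<^sub>L Z $ j $ j) = schur_map V (matrix_unit i j) $ i $ j"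
    unfolding eq by (simp add: id_tensor_def op_mat_mult_def tensor_one_def op_mat_adj_def)
  also have "\<dots> = V $ i $ j"
    by (simp add: schur_map_def matrix_unit_def)
  finally show ?thesis .
qed

section \<open>The matrix \<open>W\<close>\<close>

lemma exhaust_5:
  fixes x :: 5
  shows "x = 1 \<or> x = 2 \<or> x = 3 \<or> x = 4 \<or> x = 5"
proof (induct x)
  case (of_int z)
  \<comment> \<open>Representatives run from 0 to 4; 0 is the index written 5.\<close>
  then have "z = 0 \<or> z = 1 \<or> z = 2 \<or> z = 3 \<or> z = 4" by fastforce
  then show ?case by auto
qed

lemma sum_5: "sum f (UNIV::5 set) = f 1 + f 2 + f 3 + f 4 + f 5"
proof -
  have "UNIV = {1, 2, 3, 4, 5::5}"
    using exhaust_5 by auto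
  show ?thesis
    unfolding \<open>UNIV = {1, 2, 3, 4, 5::5}\<close> by (simp add: ac_simps)
qed

text \<open>Naming this number keeps square roots out of the matrix computations, which use only its
  square and its sign.\<close>

definition \<alpha> :: real where "\<alpha> = 2 / sqrt 6"

lemma \<alpha>_square: "\<alpha> * \<alpha> = 2 / 3"
  by (simp add: \<alpha>_def)

lemma \<alpha>_nonneg: "0 \<le> \<alpha>"
  by (simp add: \<alpha>_def)

lemma W_alt: "W = vector
    [vector [1, of_real \<alpha>, 0, 0, 1/3],
     vector [of_real \<alpha>, 1, 1/2, 0, 0],
     vector [0, 1/2, 1, 1/2, 0],
     vector [0, 0, 1/2, 1, of_real \<alpha>],
     vector [1/3, 0, 0, of_real \<alpha>, 1]]"
  by (simp only: W_def \<alpha>_def)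

text \<open>The three vectors come from Gaussian elimination on \<^const>\<open>W\<close>, with pivots in rows 3, 1, 2.\<close>

lemma W_factored: "W $ i $ j = (\<Sum>r\<in>(UNIV :: 3 set). of_real ((vector [1, 1, 1/12] :: real^3) $ r) *
  (cnj ((vector [vector [0, 1/2, 1, 1/2, 0], vector [1, of_real \<alpha>, 0, 0, 1/3],
      vector [0, 1, 0, -3, -4 * of_real \<alpha>]] :: complex^5^3) $ r $ i) *
    (vector [vector [0, 1/2, 1, 1/2, 0], vector [1, of_real \<alpha>, 0, 0, 1/3],
      vector [0, 1, 0, -3, -4 * of_real \<alpha>]] :: complex^5^3) $ r $ j))"
proof -
  have sq: "complex_of_real \<alpha> * complex_of_real \<alpha> = 2 / 3"
    using arg_cong[OF \<alpha>_square, of complex_of_real] by simp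
  show ?thesis
    using exhaust_5[of i] exhaust_5[of j]
    by (elim disjE) (simp_all only: W_alt sum_3 vector_3 vector_5, simp_all add: sq)
qed

lemma W_nonneg: "0 \<le> W $ i $ j"
  using exhaust_5[of i] exhaust_5[of j]
  by (elim disjE)
    (simp_all only: W_alt vector_5, simp_all add: less_eq_complex_def \<alpha>_nonneg)

lemma W_diagonal: "W $ i $ i = 1"
  using exhaust_5[of i] by (elim disjE) (simp_all only: W_alt vector_5)

lemma (in faithful_trace) no_positive_gram_W:
  fixes P :: "5 \<Rightarrow> 'h \<Rightarrow>\<^sub>L 'h"
  assumes PA: "\<And>i. P i \<in> A" and pos: "\<And>i. positive_op (P i)"
    and gram: "\<And>i j. \<tau> (P i o\<^sub>L P j) = W $ i $ j"
  shows False
proof -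
  note sa = positive_op_self_adjoint[OF pos]
  have sq: "complex_of_real \<alpha> * complex_of_real \<alpha> = 2 / 3"
    using arg_cong[OF \<alpha>_square, of complex_of_real] by simp
  \<comment> \<open>The two kernel vectors are normalized to end in (1, 0) and (0, 1), so that the
    relations solve for \<open>P 4\<close> and \<open>P 5\<close>.\<close>
  have "(\<Sum>j\<in>UNIV. (vector [-3 * \<alpha>, 3, -2, 1, 0] :: real^5) $ j * W $ j $ i) = 0" for i
    using exhaust_5[of i]
    by (elim disjE) (simp_all only: W_alt sum_5 vector_5, simp_all add: sq mult.assoc)
  then have "(\<Sum>j\<in>UNIV. (vector [-3 * \<alpha>, 3, -2, 1, 0] :: real^5) $ j *\<^sub>R P j) = 0"
    by (intro gram_kernel) (simp_all only: PA sa gram)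
  then have P4: "P 4 = (3 * \<alpha>) *\<^sub>R P 1 - 3 *\<^sub>R P 2 + 2 *\<^sub>R P 3"
    by (simp only: sum_5 vector_5) (simp add: algebra_simps)
  have "(\<Sum>j\<in>UNIV. (vector [-3, 4 * \<alpha>, -2 * \<alpha>, 0, 1] :: real^5) $ j * W $ j $ i) = 0" for i
    using exhaust_5[of i]
    by (elim disjE) (simp_all only: W_alt sum_5 vector_5, simp_all add: sq mult.assoc)
  then have "(\<Sum>j\<in>UNIV. (vector [-3, 4 * \<alpha>, -2 * \<alpha>, 0, 1] :: real^5) $ j *\<^sub>R P j) = 0"
    by (intro gram_kernel) (simp_all only: PA sa gram)
  then have P5: "P 5 = 3 *\<^sub>R P 1 - (4 * \<alpha>) *\<^sub>R P 2 + (2 * \<alpha>) *\<^sub>R P 3"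
    by (simp only: sum_5 vector_5) (simp add: algebra_simps)
  \<comment> \<open>Products become iterated applications, and the relations become linear algebra
    on vectors.\<close>
  define p where "p i x = blinfun_apply (P i) x" for i x
  have orth: "p i (p j x) = 0" if "W $ i $ j = 0" for i j x
  proof -
    have "P i o\<^sub>L P j = 0"
      using that by (intro trace_compose_eq_0 PA pos) (simp add: gram)
    then show ?thesis
      unfolding p_def by (metis blinfun_apply_blinfun_compose zero_blinfun.rep_eq)
  qed
  have W0: "W $ 1 $ 4 = 0" "W $ 4 $ 1 = 0" "W $ 1 $ 3 = 0" "W $ 3 $ 1 = 0" "W $ 4 $ 2 = 0"
    "W $ 5 $ 2 = 0"
    by (simp_all only: W_alt vector_5)
  have p4: "p 4 x = (3 * \<alpha>) *\<^sub>R p 1 x - 3 *\<^sub>R p 2 x + 2 *\<^sub>R p 3 x" for x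
    by (simp only: p_def P4 blinfun.add_left blinfun.diff_left blinfun.scaleR_left)
  have p5: "p 5 x = 3 *\<^sub>R p 1 x - (4 * \<alpha>) *\<^sub>R p 2 x + (2 * \<alpha>) *\<^sub>R p 3 x" for x
    by (simp only: p_def P5 blinfun.add_left blinfun.diff_left blinfun.scaleR_left)
  note lin = blinfun.add_right blinfun.diff_right blinfun.scaleR_right
  \<comment> \<open>Multiply the relation for \<open>P 4\<close> by \<open>P 1\<close> on the right:
    the products of \<open>P 4\<close> and \<open>P 3\<close> with \<open>P 1\<close>
    vanish.\<close>
  have p21: "p 2 (p 1 x) = \<alpha> *\<^sub>R p 1 (p 1 x)" for x
  proof -
    have "3 *\<^sub>R (p 2 (p 1 x) - \<alpha> *\<^sub>R p 1 (p 1 x)) = 0"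
      using orth[OF W0(2), of x] p4[of "p 1 x"] orth[OF W0(4), of x] by (simp add: algebra_simps)
    then show ?thesis
      by simp
  qed
  \<comment> \<open>The same relation, now multiplied by \<open>P 1\<close> on the left.\<close>
  have p12: "p 1 (p 2 x) = \<alpha> *\<^sub>R p 1 (p 1 x)" for x
  proof -
    have "3 *\<^sub>R (p 1 (p 2 x) - \<alpha> *\<^sub>R p 1 (p 1 x)) = p 1 (2 *\<^sub>R p 3 x) - p 1 (p 4 x)"
      unfolding p4 by (simp add: p_def lin algebra_simps)
    also have "\<dots> = 0"
      using orth[OF W0(1), of x] orth[OF W0(3), of x] by (simp add: p_def lin)
    finally show ?thesis
      by simp
  qed
  \<comment> \<open>Since \<alpha> squared is 2/3, \<open>P 5 - \<alpha> *\<^sub>R P 4\<close> loses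
    its \<open>P 3\<close> term and equals \<open>P 1 - \<alpha> *\<^sub>R P 2\<close>. Both
    \<open>P 5\<close> and \<open>P 4\<close> annihilate the range of \<open>P 2\<close>.\<close>
  have p22: "p 2 (p 2 x) = p 1 (p 1 x)" for x
  proof -
    let ?u = "p 1 (p 2 x)" and ?v = "p 2 (p 2 x)" and ?w = "p 3 (p 2 x)"
    have "\<alpha> * (3 * \<alpha>) = 2"
      using \<alpha>_square by simp
    then have "\<alpha> *\<^sub>R p 4 (p 2 x) = 2 *\<^sub>R ?u - (3 * \<alpha>) *\<^sub>R ?v + (2 * \<alpha>) *\<^sub>R ?w"
      unfolding p4[of "p 2 x"] by (simp add: scaleR_add_right scaleR_diff_right mult.commute)
    \<comment> \<open>The coefficients 3 and 4\<alpha> are split to expose the summands that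
      cancel.\<close>
    moreover have "p 5 (p 2 x) = (2 + 1) *\<^sub>R ?u - (3 * \<alpha> + \<alpha>) *\<^sub>R ?v + (2 * \<alpha>) *\<^sub>R ?w"
      unfolding p5[of "p 2 x"] by simp
    ultimately have "?u - \<alpha> *\<^sub>R ?v = p 5 (p 2 x) - \<alpha> *\<^sub>R p 4 (p 2 x)"
      by (simp only: scaleR_add_left scaleR_one) (simp add: algebra_simps)
    then have "\<alpha> *\<^sub>R (p 1 (p 1 x) - p 2 (p 2 x)) = 0"
      using orth[OF W0(5), of x] orth[OF W0(6), of x] by (simp add: p12 algebra_simps)
    then show ?thesis
      using \<alpha>_square by auto
  qed
  \<comment> \<open>One use of \<open>p22\<close> and two of \<open>p21\<close> return the cube
    multiplied by 2/3.\<close>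
  have "p 1 (p 1 (p 1 x)) = 0" for x
  proof -
    have "p 1 (p 1 (p 1 x)) = p 2 (p 2 (p 1 x))"
      by (simp only: p22)
    also have "\<dots> = \<alpha> *\<^sub>R (p 2 (p 1 (p 1 x)))"
      unfolding p21[of x] by (simp add: p_def lin)
    also have "\<dots> = (2 / 3) *\<^sub>R p 1 (p 1 (p 1 x))"
      by (simp add: p21 \<alpha>_square)
    finally have "1 *\<^sub>R p 1 (p 1 (p 1 x)) = (2 / 3) *\<^sub>R p 1 (p 1 (p 1 x))"
      by (simp only: scaleR_one)
    then show ?thesis
      by (simp only: scaleR_cancel_right) simp
  qed
  \<comment> \<open>The fourth power is taken because it is the square of a self-adjoint
    operator.\<close>
  then have "(P 1 o\<^sub>L P 1) o\<^sub>L (P 1 o\<^sub>L P 1) = 0"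
    by (intro blinfun_eqI) (simp add: p_def blinfun.zero_right)
  moreover have "self_adjoint (P 1 o\<^sub>L P 1)"
    by (intro positive_op_self_adjoint positive_op_square positive_op_bounded pos sa)
  ultimately have "P 1 o\<^sub>L P 1 = 0"
    by (rule self_adjoint_square_eq_0[rotated])
  moreover have "\<tau> (0::'h \<Rightarrow>\<^sub>L 'h) = 0"
    using trace_diff[OF id_in id_in] by simp
  ultimately show False
    using gram[of 1 1] by (simp add: W_diagonal)
qed

theorem theorem6p4:
  shows "completely_positive (schur_map W) \<and> trace_preserving (schur_map W) \<and>
    \<not> positively_factorizable TYPE('h::chilbert_space) (schur_map W) \<and>
    entrywise_nonneg (choi_matrix (schur_map W)) \<and> psd (choi_matrix (schur_map W))"
proof (intro conjI)
  \<comment> \<open>Nonnegative pivots yield both complete positivity and positivity of the Choi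
    matrix.\<close>
  have d: "0 \<le> (vector [1, 1, 1/12] :: real^3) $ r" for r
    using exhaust_3[of r] by (elim disjE) (simp_all add: vector_3)
  show "completely_positive (schur_map W)"
    by (rule completely_positive_schur_map_factored[OF W_factored d])
  show "psd (choi_matrix (schur_map W))"
    by (rule psd_choi_matrix_schur_map_factored[OF W_factored d])
  show "trace_preserving (schur_map W)"
    by (simp add: trace_preserving_def trace_def schur_map_def W_diagonal)
  show "entrywise_nonneg (choi_matrix (schur_map W))"
    by (simp add: entrywise_nonneg_def choi_matrix_schur_map W_nonneg)
  show "\<not> positively_factorizable TYPE('h) (schur_map W)"
  proof
    assume "positively_factorizable TYPE('h) (schur_map W)"
    then obtain A \<tau> and Z :: "('h \<Rightarrow>\<^sub>L 'h)^5^5" where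
      vN: "finite_von_neumann_algebra A" and tr: "finite_trace A \<tau>" "faithful_on A \<tau>"
      and Z: "\<And>i j. Z $ i $ j \<in> A" "\<And>i j. positive_op (Z $ i $ j)"
      and eq: "\<And>X. schur_map W X =
        id_tensor \<tau> (op_mat_mult (op_mat_mult Z (tensor_one X)) (op_mat_adj Z))"
      unfolding positively_factorizable_def by blast
    interpret faithful_trace A \<tau>
      using vN tr
      by unfold_locales (simp_all add: finite_von_neumann_algebra_def von_neumann_algebra_def)
    show False
      by (rule no_positive_gram_W[of "\<lambda>i. Z $ i $ i"])
        (simp_all only: Z schur_map_factorization_diagonal[OF eq Z(2)])
  qed
qed

end
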